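(* Let $\mathscr{H}Q_{2k}=Q_{2k+2}\widetilde{T}_{2k}$ be a decomposition computed by the $\Gamma$-Lanczos algorithm (form recalled in the context), let $q_{k+1}$ be the $(k+1)$-th column of $Q_{2k+2}$, let $Q=\begin{bmatrix}Q_{2k+2}&Q_u\end{bmatrix}\in\mathbb{C}^{2n\times 2n}$ be a nonsingular completion as in the context, and let $$\mathbf{H}_{11}=\begin{bmatrix}T_{11}&-\overline{T}_{21}\\ T_{21}&-\overline{T}_{11}\end{bmatrix}\in\mathbb{C}^{2k\times 2k}.$$ If $\mathbf{H}_{11}x=\nu x$ with $0\ne x\in\mathbb{C}^{2k}$ and $\nu\in\mathbb{C}$, then: (i) $\|Q^{-1}(\mathscr{H}Q_{2k}-Q_{2k}\mathbf{H}_{11})\|_2=\min\{\|Q^{-1}(\mathscr{H}Q_{2k}-Q_{2k}S)\|_2: S\in\mathbb{C}^{2k\times 2k}\}=|\beta_k|$; (ii) $\mathscr{H}Q_{2k}x-\nu Q_{2k}x=\beta_k\xi_kq_{k+1}-\xi_{2k}\overline{\beta}_k\Pi\overline{q}_{k+1}$, where $\xi_k$ and $\xi_{2k}$ are the $k$-th and $2k$-th entries of $x$.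
   Context: $\mathscr{H}=\begin{bmatrix}A&B\\-\overline{B}&-\overline{A}\end{bmatrix}\in\mathbb{C}^{2n\times 2n}$, where $A,B\in\mathbb{C}^{n\times n}$ satisfy $A^H=A$, $B^T=B$. $\Pi=\begin{bmatrix}0&I_n\\ I_n&0\end{bmatrix}$, $\Gamma_0=\mathrm{diag}(I_n,-I_n)$, $\mathbf{\Gamma}_{2m}=\{\mathrm{diag}(J,-J): J$ an $m\times m$ diagonal matrix with diagonal entries $\pm1\}$. The $\Gamma$-Lanczos algorithm produces $\mathscr{H}Q_{2k}=Q_{2k+2}\widetilde{T}_{2k}$ with $$Q_{2k+2}=\begin{bmatrix}q_1&\cdots&q_{k+1}&\Pi\overline{q}_1&\cdots&\Pi\overline{q}_{k+1}\end{bmatrix},\qquad Q_{2k}=\begin{bmatrix}q_1&\cdots&q_k&\Pi\overline{q}_1&\cdots&\Pi\overline{q}_k\end{bmatrix},$$ $Q_{2k+2}^H\Gamma_0Q_{2k+2}=\Gamma_{2k+2}$ for some $\Gamma_{2k+2}\in\mathbf{\Gamma}_{2k+2}$, and $$\widetilde{T}_{2k}=\begin{bmatrix}T_{11}&-\overline{T}_{21}\\ \beta_ke_k^T&0\\ T_{21}&-\overline{T}_{11}\\0&-\overline{\beta}_ke_k^T\end{bmatrix}\in\mathbb{C}^{(2k+2)\times 2k},$$ where $T_{11}\in\mathbb{C}^{k\times k}$ is unreduced tridiagonal (all sub-diagonal entries nonzero), $T_{21}\in\mathbb{C}^{k\times k}$ is diagonal, $\beta_k\in\mathbb{C}$, and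 $e_k\in\mathbb{C}^k$ is the $k$-th unit vector. Completion: $Q_u\in\mathbb{C}^{2n\times(2n-2k-2)}$ is a matrix of the form $\begin{bmatrix}G_1&G_2\\ \overline{G}_2&\overline{G}_1\end{bmatrix}$ with $G_1,G_2\in\mathbb{C}^{n\times(n-k-1)}$ such that $Q=\begin{bmatrix}Q_{2k+2}&Q_u\end{bmatrix}$ is nonsingular and $Q^H\Gamma_0Q=\mathrm{diag}(\Gamma_{2k+2},\Gamma_{2n-2k-2})$ for some $\Gamma_{2n-2k-2}\in\mathbf{\Gamma}_{2n-2k-2}$ (such a $Q_u$ always exists). $\|\cdot\|_2$ is the spectral norm. *)

theory Defs
  imports
    "HOL-Analysis.L2_Norm"
    "Jordan_Normal_Form.Matrix"
    "Jordan_Normal_Form.Gauss_Jordan_Elimination"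
    "Jordan_Normal_Form.Schur_Decomposition"
begin

definition mat_conj :: "complex mat \<Rightarrow> complex mat" where
  "mat_conj A = map_mat cnj A"

(* Counterpart of append_rows: [A B]. *)
definition append_cols :: "'a :: zero mat \<Rightarrow> 'a mat \<Rightarrow> 'a mat" (infixr "@\<^sub>c" 66) where
  "A @\<^sub>c B = four_block_mat A B (0\<^sub>m 0 (dim_col A)) (0\<^sub>m 0 (dim_col B))"

definition vec_norm2 :: "complex vec \<Rightarrow> real" where
  "vec_norm2 v = L2_set (\<lambda>i. cmod (v $ i)) {..<dim_vec v}"

(* Operator norm induced by the Euclidean norms; taking the supremum over the closed unit ball
   rather than the unit sphere only serves to give the value 0 when there are no columns. *)
definition spectral_norm :: "complex mat \<Rightarrow> real" where
  "spectral_norm A =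
     (SUP v \<in> {v \<in> carrier_vec (dim_col A). vec_norm2 v \<le> 1}. vec_norm2 (A *\<^sub>v v))"

definition is_minimum :: "real \<Rightarrow> real set \<Rightarrow> bool" where
  "is_minimum m X \<longleftrightarrow> m \<in> X \<and> (\<forall>y\<in>X. m \<le> y)"

definition ham_mat :: "complex mat \<Rightarrow> complex mat \<Rightarrow> complex mat" where
  "ham_mat A B = four_block_mat A B (- mat_conj B) (- mat_conj A)"

definition Pi_mat :: "nat \<Rightarrow> complex mat" where
  "Pi_mat n = four_block_mat (0\<^sub>m n n) (1\<^sub>m n) (1\<^sub>m n) (0\<^sub>m n n)"

definition Gamma0 :: "nat \<Rightarrow> complex mat" where
  "Gamma0 n = diag_block_mat [1\<^sub>m n, - 1\<^sub>m n]"

(* Gamma_set m is the set of 2m x 2m matrices diag(J, -J). *)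
definition Gamma_set :: "nat \<Rightarrow> complex mat set" where
  "Gamma_set m = {diag_block_mat [J, - J] | J.
     J \<in> carrier_mat m m \<and> diagonal_mat J \<and> (\<forall>i<m. J $$ (i, i) = 1 \<or> J $$ (i, i) = - 1)}"

(* The 2n x 2m matrix [q_1 ... q_m  Pi cnj(q_1) ... Pi cnj(q_m)]. The vectors q are indexed
   from 1, whereas matrix and vector entries are indexed from 0. *)
definition lanczos_basis :: "nat \<Rightarrow> (nat \<Rightarrow> complex vec) \<Rightarrow> nat \<Rightarrow> complex mat" where
  "lanczos_basis n q m = mat_of_cols (2 * n)
     (map q [1..<m + 1] @ map (\<lambda>j. Pi_mat n *\<^sub>v conjugate (q j)) [1..<m + 1])"

definition unreduced_tridiagonal :: "complex mat \<Rightarrow> bool" where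
  "unreduced_tridiagonal T \<longleftrightarrow>
     (\<forall>i < dim_row T. \<forall>j < dim_col T. i + 1 < j \<or> j + 1 < i \<longrightarrow> T $$ (i, j) = 0) \<and>
     (\<forall>i. i + 1 < dim_row T \<longrightarrow> T $$ (i + 1, i) \<noteq> 0)"

definition lanczos_H11 :: "complex mat \<Rightarrow> complex mat \<Rightarrow> complex mat" where
  "lanczos_H11 T11 T21 = four_block_mat T11 (- mat_conj T21) T21 (- mat_conj T11)"

(* The (2k+2) x 2k matrix T-tilde; the row vector e_k^T is mat_of_row (unit_vec k (k - 1)). *)
definition lanczos_Ttilde :: "nat \<Rightarrow> complex mat \<Rightarrow> complex mat \<Rightarrow> complex \<Rightarrow> complex mat" where
  "lanczos_Ttilde k T11 T21 \<beta> =
     (T11 @\<^sub>c - mat_conj T21) @\<^sub>r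
     (\<beta> \<cdot>\<^sub>m mat_of_row (unit_vec k (k - 1)) @\<^sub>c 0\<^sub>m 1 k) @\<^sub>r
     (T21 @\<^sub>c - mat_conj T11) @\<^sub>r
     (0\<^sub>m 1 k @\<^sub>c (- cnj \<beta>) \<cdot>\<^sub>m mat_of_row (unit_vec k (k - 1)))"

definition gamma_lanczos_decomp ::
  "nat \<Rightarrow> nat \<Rightarrow> complex mat \<Rightarrow> complex mat \<Rightarrow> (nat \<Rightarrow> complex vec) \<Rightarrow> complex mat \<Rightarrow>
   complex mat \<Rightarrow> complex mat \<Rightarrow> complex \<Rightarrow> bool" where
  "gamma_lanczos_decomp n k A B q \<Gamma> T11 T21 \<beta> \<longleftrightarrow>
     0 < k \<and> k < n \<and>
     (\<forall>j\<in>{1..k + 1}. q j \<in> carrier_vec (2 * n)) \<and>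
     T11 \<in> carrier_mat k k \<and> unreduced_tridiagonal T11 \<and>
     T21 \<in> carrier_mat k k \<and> diagonal_mat T21 \<and>
     \<Gamma> \<in> Gamma_set (k + 1) \<and>
     mat_adjoint (lanczos_basis n q (k + 1)) * Gamma0 n * lanczos_basis n q (k + 1) = \<Gamma> \<and>
     ham_mat A B * lanczos_basis n q k = lanczos_basis n q (k + 1) * lanczos_Ttilde k T11 T21 \<beta>"

definition lanczos_completion ::
  "nat \<Rightarrow> nat \<Rightarrow> (nat \<Rightarrow> complex vec) \<Rightarrow> complex mat \<Rightarrow> complex mat \<Rightarrow> bool" where
  "lanczos_completion n k q \<Gamma> Q\<^sub>u \<longleftrightarrow>
     (\<exists>G1 G2. G1 \<in> carrier_mat n (n - k - 1) \<and> G2 \<in> carrier_mat n (n - k - 1) \<and>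
        Q\<^sub>u = four_block_mat G1 G2 (mat_conj G2) (mat_conj G1)) \<and>
     (let Q = lanczos_basis n q (k + 1) @\<^sub>c Q\<^sub>u in
        invertible_mat Q \<and>
        (\<exists>\<Gamma>' \<in> Gamma_set (n - k - 1). mat_adjoint Q * Gamma0 n * Q = diag_block_mat [\<Gamma>, \<Gamma>']))"

end

theory Submission
  imports Defs
begin

text \<open>The basis \<open>Q\<^sub>2\<^sub>k\<close> consists of columns of \<open>Q\<^sub>2\<^sub>k\<^sub>+\<^sub>2\<close>: all of them except \<open>q\<^sub>k\<^sub>+\<^sub>1\<close> and
  \<open>\<Pi> cnj q\<^sub>k\<^sub>+\<^sub>1\<close>. Hence \<open>Q\<^sub>2\<^sub>k = Q\<^sub>2\<^sub>k\<^sub>+\<^sub>2 F\<close> for a 0-1 matrix \<open>F\<close> that spreads \<open>2k\<close> rows over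
  \<open>2k + 2\<close> positions and leaves rows \<open>k\<close> and \<open>2k + 1\<close> (counted from 0) empty. The matrix
  \<open>T\<close>-tilde is \<open>H\<^sub>1\<^sub>1\<close> spread out in this way, plus a matrix \<open>D\<close> that lives exactly on the two
  empty rows, with one entry of modulus \<open>|\<beta>|\<close> in each (\<open>lanczos_Ttilde_split\<close>). Therefore
  \<open>H Q\<^sub>2\<^sub>k - Q\<^sub>2\<^sub>k S = Q\<^sub>2\<^sub>k\<^sub>+\<^sub>2 (D + F (H\<^sub>1\<^sub>1 - S))\<close> for every \<open>S\<close> (\<open>lanczos_residual_factor\<close>).

  Multiplication by \<open>Q\<^sup>-\<^sup>1\<close> turns \<open>Q\<^sub>2\<^sub>k\<^sub>+\<^sub>2\<close> into the first \<open>2k + 2\<close> columns of the identity, so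
  that \<open>Q\<^sup>-\<^sup>1 (H Q\<^sub>2\<^sub>k - Q\<^sub>2\<^sub>k S)\<close> is \<open>D + F (H\<^sub>1\<^sub>1 - S)\<close> followed by zero rows. The choice of \<open>S\<close>
  cannot influence row \<open>k\<close>, so \<open>\<beta>\<close> is always an entry of this matrix, and its spectral
  norm is at least \<open>|\<beta>|\<close>. For \<open>S = H\<^sub>1\<^sub>1\<close> only \<open>D\<close> remains; its two nonzero entries lie in
  different rows and different columns, so its norm is \<open>|\<beta>|\<close>.

  If \<open>H\<^sub>1\<^sub>1 x = \<nu> x\<close>, then applying the residual for \<open>S = H\<^sub>1\<^sub>1\<close> to \<open>x\<close> gives
  \<open>Q\<^sub>2\<^sub>k\<^sub>+\<^sub>2 (D x)\<close>, a combination of the two columns of \<open>Q\<^sub>2\<^sub>k\<^sub>+\<^sub>2\<close> missing from \<open>Q\<^sub>2\<^sub>k\<close>.\<close>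

section \<open>The spectral norm\<close>

lemma cmod_index_le_vec_norm2:
  assumes "i < dim_vec v"
  shows "cmod (v $ i) \<le> vec_norm2 v"
  unfolding vec_norm2_def using assms
  by (intro member_le_L2_set) auto

lemma vec_norm2_unit_vec:
  assumes "j < n"
  shows "vec_norm2 (unit_vec n j) = 1"
proof -
  have "vec_norm2 (unit_vec n j) = L2_set (\<lambda>i. if i = j then 1 else 0) {..<n}"
    unfolding vec_norm2_def using assms by (auto intro!: L2_set_cong)
  then show ?thesis using assms by (simp add: L2_set_def if_distrib[of "\<lambda>x. x\<^sup>2"] cong: if_cong)
qed

text \<open>The crude bound by the sum of the moduli of all entries. Its only purpose is to show that
  the supremum that defines the spectral norm is taken over a bounded set.\<close>

lemma vec_norm2_mult_mat_vec_le:
  assumes v: "v \<in> carrier_vec (dim_col A)" "vec_norm2 v \<le> 1"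
  shows "vec_norm2 (A *\<^sub>v v) \<le> (\<Sum>i<dim_row A. \<Sum>j<dim_col A. cmod (A $$ (i, j)))"
proof -
  have "vec_norm2 (A *\<^sub>v v) \<le> (\<Sum>i<dim_row A. cmod ((A *\<^sub>v v) $ i))"
    unfolding vec_norm2_def dim_mult_mat_vec by (intro L2_set_le_sum) simp
  also have "\<dots> \<le> (\<Sum>i<dim_row A. \<Sum>j<dim_col A. cmod (A $$ (i, j)))"
  proof (rule sum_mono)
    fix i assume i: "i \<in> {..<dim_row A}"
    have "(A *\<^sub>v v) $ i = (\<Sum>j<dim_col A. A $$ (i, j) * v $ j)"
      using i v by (auto simp: scalar_prod_def atLeast0LessThan)
    also have "cmod \<dots> \<le> (\<Sum>j<dim_col A. cmod (A $$ (i, j)) * cmod (v $ j))"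
      by (rule order_trans[OF norm_sum]) (simp add: norm_mult)
    also have "\<dots> \<le> (\<Sum>j<dim_col A. cmod (A $$ (i, j)))"
      using v by (intro sum_mono mult_left_le order_trans[OF cmod_index_le_vec_norm2]) auto
    finally show "cmod ((A *\<^sub>v v) $ i) \<le> (\<Sum>j<dim_col A. cmod (A $$ (i, j)))" .
  qed
  finally show ?thesis .
qed

lemma vec_norm2_le_spectral_norm:
  assumes "v \<in> carrier_vec (dim_col A)" "vec_norm2 v \<le> 1"
  shows "vec_norm2 (A *\<^sub>v v) \<le> spectral_norm A"
  unfolding spectral_norm_def using assms
  by (intro cSUP_upper bdd_aboveI2[where M = "\<Sum>i<dim_row A. \<Sum>j<dim_col A. cmod (A $$ (i, j))"])
    (auto intro: vec_norm2_mult_mat_vec_le)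

lemma spectral_norm_le:
  assumes "\<And>v. v \<in> carrier_vec (dim_col A) \<Longrightarrow> vec_norm2 v \<le> 1 \<Longrightarrow> vec_norm2 (A *\<^sub>v v) \<le> c"
  shows "spectral_norm A \<le> c"
proof -
  have "0\<^sub>v (dim_col A) \<in> {v \<in> carrier_vec (dim_col A). vec_norm2 v \<le> 1}"
    by (auto simp: vec_norm2_def L2_set_def)
  then show ?thesis
    unfolding spectral_norm_def using assms by (intro cSUP_least) blast+
qed

lemma mult_mat_vec_unit_vec:
  fixes A :: "'a :: semiring_1 mat"
  assumes "A \<in> carrier_mat m r" "j < r"
  shows "A *\<^sub>v unit_vec r j = col A j"
  using assms by (intro eq_vecI) (auto simp: scalar_prod_right_unit)

text \<open>The image of the \<open>j\<close>-th unit vector is the \<open>j\<close>-th column, whose norm dominates each of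
  its entries.\<close>

lemma cmod_index_le_spectral_norm:
  assumes "i < dim_row A" "j < dim_col A"
  shows "cmod (A $$ (i, j)) \<le> spectral_norm A"
proof -
  have "cmod (A $$ (i, j)) = cmod ((A *\<^sub>v unit_vec (dim_col A) j) $ i)"
    using assms by (subst mult_mat_vec_unit_vec[where m = "dim_row A"]) auto
  also have "\<dots> \<le> vec_norm2 (A *\<^sub>v unit_vec (dim_col A) j)"
    using assms by (intro cmod_index_le_vec_norm2) simp
  also have "\<dots> \<le> spectral_norm A"
    using assms by (intro vec_norm2_le_spectral_norm) (auto simp: vec_norm2_unit_vec)
  finally show ?thesis .
qed

section \<open>Column selection\<close>

text \<open>Right multiplication by this matrix picks the columns \<open>f 0, f 1, \<dots>\<close>; left multiplication
  by it moves row \<open>j\<close> to row \<open>f j\<close>, if \<open>f\<close> is injective.\<close>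

definition selection_mat :: "nat \<Rightarrow> nat \<Rightarrow> (nat \<Rightarrow> nat) \<Rightarrow> complex mat" where
  "selection_mat r c f = mat r c (\<lambda>(i, j). if i = f j then 1 else 0)"

lemma selection_mat_carrier [simp]: "selection_mat r c f \<in> carrier_mat r c"
  by (simp add: selection_mat_def)

lemma dim_selection_mat [simp]:
  "dim_row (selection_mat r c f) = r" "dim_col (selection_mat r c f) = c"
  by (simp_all add: selection_mat_def)

lemma mult_selection_mat_index:
  assumes "A \<in> carrier_mat m r" "i < m" "j < c" "f j < r"
  shows "(A * selection_mat r c f) $$ (i, j) = A $$ (i, f j)"
proof -
  have "(A * selection_mat r c f) $$ (i, j) = (\<Sum>l<r. A $$ (i, l) * (if l = f j then 1 else 0))"
    using assms by (auto simp: selection_mat_def scalar_prod_def atLeast0LessThan)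
  also have "\<dots> = (\<Sum>l<r. if l = f j then A $$ (i, l) else 0)"
    by (intro sum.cong) auto
  finally show ?thesis using assms by simp
qed

lemma selection_mat_mult_index:
  assumes "X \<in> carrier_mat c p" "l < c" "j < p" "f l < r" "inj_on f {..<c}"
  shows "(selection_mat r c f * X) $$ (f l, j) = X $$ (l, j)"
proof -
  have "(selection_mat r c f * X) $$ (f l, j) = (\<Sum>m<c. (if f l = f m then 1 else 0) * X $$ (m, j))"
    using assms by (auto simp: selection_mat_def scalar_prod_def atLeast0LessThan)
  also have "\<dots> = (\<Sum>m<c. if m = l then X $$ (m, j) else 0)"
    using assms by (intro sum.cong) (auto dest: inj_onD)
  finally show ?thesis using assms by simp
qed

lemma selection_mat_mult_index_outside:
  assumes "X \<in> carrier_mat c p" "i < r" "j < p" "i \<notin> f ` {..<c}"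
  shows "(selection_mat r c f * X) $$ (i, j) = 0"
  using assms by (auto simp: selection_mat_def scalar_prod_def intro!: sum.neutral)

lemma selection_mat_id_mult_index:
  assumes "X \<in> carrier_mat c p" "c \<le> r" "i < r" "j < p"
  shows "(selection_mat r c (\<lambda>j. j) * X) $$ (i, j) = (if i < c then X $$ (i, j) else 0)"
  using selection_mat_mult_index[of X c p i j "\<lambda>j. j" r]
    selection_mat_mult_index_outside[of X c p i r j "\<lambda>j. j"] assms
  by (auto simp: inj_on_def)

section \<open>The residual in Lanczos coordinates\<close>

text \<open>The position in \<open>Q\<^sub>2\<^sub>k\<^sub>+\<^sub>2\<close> of column \<open>j\<close> of \<open>Q\<^sub>2\<^sub>k\<close>. The value \<open>k\<close> is skipped because
  \<open>q\<^sub>k\<^sub>+\<^sub>1\<close> sits there, and \<open>2k + 1\<close> because \<open>\<Pi> cnj q\<^sub>k\<^sub>+\<^sub>1\<close> comes last.\<close>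

definition lanczos_position :: "nat \<Rightarrow> nat \<Rightarrow> nat" where
  "lanczos_position k j = (if j < k then j else j + 1)"

definition lanczos_embedding :: "nat \<Rightarrow> complex mat" where
  "lanczos_embedding k = selection_mat (2 * k + 2) (2 * k) (lanczos_position k)"

definition residual_coeffs :: "nat \<Rightarrow> complex \<Rightarrow> complex mat" where
  "residual_coeffs k \<beta> = mat (2 * k + 2) (2 * k) (\<lambda>(i, j).
     if i = k \<and> j = k - 1 then \<beta>
     else if i = 2 * k + 1 \<and> j = 2 * k - 1 then - cnj \<beta> else 0)"

lemma dim_lanczos_embedding [simp]:
  "dim_row (lanczos_embedding k) = 2 * k + 2" "dim_col (lanczos_embedding k) = 2 * k"
  by (simp_all add: lanczos_embedding_def)

lemma dim_residual_coeffs [simp]: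
  "dim_row (residual_coeffs k \<beta>) = 2 * k + 2" "dim_col (residual_coeffs k \<beta>) = 2 * k"
  by (simp_all add: residual_coeffs_def)

lemma dim_lanczos_basis [simp]:
  "dim_row (lanczos_basis n q m) = 2 * n" "dim_col (lanczos_basis n q m) = 2 * m"
  by (simp_all add: lanczos_basis_def del: upt_Suc)

lemma lanczos_embedding_carrier: "lanczos_embedding k \<in> carrier_mat (2 * k + 2) (2 * k)"
  by (simp add: carrier_matI)

lemma residual_coeffs_carrier: "residual_coeffs k \<beta> \<in> carrier_mat (2 * k + 2) (2 * k)"
  by (simp add: carrier_matI)

lemma lanczos_basis_carrier: "lanczos_basis n q m \<in> carrier_mat (2 * n) (2 * m)"
  by (simp add: carrier_matI)

lemma lanczos_H11_carrier:
  assumes "T11 \<in> carrier_mat k k" "T21 \<in> carrier_mat k k"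
  shows "lanczos_H11 T11 T21 \<in> carrier_mat (2 * k) (2 * k)"
  using assms by (auto simp: lanczos_H11_def mat_conj_def)

lemma lanczos_Ttilde_carrier:
  assumes "T11 \<in> carrier_mat k k" "T21 \<in> carrier_mat k k"
  shows "lanczos_Ttilde k T11 T21 \<beta> \<in> carrier_mat (2 * k + 2) (2 * k)"
  using assms
  by (auto simp: lanczos_Ttilde_def append_rows_def append_cols_def mat_conj_def)

lemma lanczos_embedding_mult_index:
  assumes "X \<in> carrier_mat (2 * k) p" "i < 2 * k + 2" "j < p"
  shows "(lanczos_embedding k * X) $$ (i, j) =
    (if i < k then X $$ (i, j) else if i = k \<or> i = 2 * k + 1 then 0 else X $$ (i - 1, j))"
proof -
  have inj: "inj_on (lanczos_position k) {..<2 * k}"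
    by (auto simp: inj_on_def lanczos_position_def split: if_splits)
  consider "i < k" | "i = k \<or> i = 2 * k + 1" | "k < i" "i < 2 * k + 1"
    using assms by linarith
  then show ?thesis
  proof cases
    case 1
    then show ?thesis
      using selection_mat_mult_index[OF assms(1) _ assms(3) _ inj, of i "2 * k + 2"]
      by (simp add: lanczos_embedding_def lanczos_position_def)
  next
    case 2
    then have "i \<notin> lanczos_position k ` {..<2 * k}"
      by (auto simp: lanczos_position_def)
    with 2 show ?thesis
      using selection_mat_mult_index_outside[OF assms(1,2,3)]
      by (auto simp: lanczos_embedding_def)
  next
    case 3
    then have "lanczos_position k (i - 1) = i"
      by (auto simp: lanczos_position_def)
    with 3 show ?thesis
      using selection_mat_mult_index[OF assms(1) _ assms(3) _ inj, of "i - 1" "2 * k + 2"]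
      by (simp add: lanczos_embedding_def)
  qed
qed

lemma lanczos_basis_col:
  assumes "j < 2 * m" "\<And>i. 1 \<le> i \<Longrightarrow> i \<le> m \<Longrightarrow> q i \<in> carrier_vec (2 * n)"
  shows "col (lanczos_basis n q m) j =
    (if j < m then q (j + 1) else Pi_mat n *\<^sub>v conjugate (q (j - m + 1)))"
proof -
  have "Pi_mat n \<in> carrier_mat (2 * n) (2 * n)"
    by (auto simp: Pi_mat_def)
  then show ?thesis
    unfolding lanczos_basis_def using assms
    by (subst col_mat_of_cols) (auto simp: nth_append simp del: map_upt_Suc upt_Suc)
qed

lemma lanczos_basis_eq_mult_embedding:
  assumes "\<And>i. 1 \<le> i \<Longrightarrow> i \<le> k + 1 \<Longrightarrow> q i \<in> carrier_vec (2 * n)"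
  shows "lanczos_basis n q k = lanczos_basis n q (k + 1) * lanczos_embedding k"
proof (rule eq_matI)
  let ?Q = "lanczos_basis n q (k + 1)"
  fix i j assume "i < dim_row (?Q * lanczos_embedding k)" "j < dim_col (?Q * lanczos_embedding k)"
  then have ij: "i < 2 * n" "j < 2 * k"
    using lanczos_basis_carrier[of n q "k + 1"] lanczos_embedding_carrier[of k] by auto
  let ?p = "lanczos_position k j"
  have p: "?p < 2 * (k + 1)"
    using ij by (auto simp: lanczos_position_def)
  have Q: "?Q \<in> carrier_mat (2 * n) (2 * k + 2)"
    using lanczos_basis_carrier[of n q "k + 1"] by simp
  have "lanczos_basis n q k $$ (i, j) = col (lanczos_basis n q k) j $ i"
    using ij lanczos_basis_carrier[of n q k] by simp
  also have "col (lanczos_basis n q k) j = col ?Q ?p"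
    using ij p assms by (subst (1 2) lanczos_basis_col) (auto simp: lanczos_position_def Suc_diff_le)
  also have "\<dots> $ i = ?Q $$ (i, ?p)"
    using ij p Q by simp
  also have "\<dots> = (?Q * lanczos_embedding k) $$ (i, j)"
    unfolding lanczos_embedding_def using ij p
    by (intro mult_selection_mat_index[OF Q, symmetric]) auto
  finally show "lanczos_basis n q k $$ (i, j) = (?Q * lanczos_embedding k) $$ (i, j)" .
qed (use lanczos_basis_carrier[of n q k] lanczos_basis_carrier[of n q "k + 1"]
      lanczos_embedding_carrier[of k] in auto)

text \<open>The rows of \<open>T\<close>-tilde with index \<open>k\<close> and \<open>2k + 1\<close> are the rows of
  \<open>residual_coeffs k \<beta>\<close>; deleting them leaves \<open>H\<^sub>1\<^sub>1\<close>.\<close>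

lemma lanczos_Ttilde_split:
  assumes T: "T11 \<in> carrier_mat k k" "T21 \<in> carrier_mat k k" and k: "0 < k"
  shows "lanczos_Ttilde k T11 T21 \<beta> =
    residual_coeffs k \<beta> + lanczos_embedding k * lanczos_H11 T11 T21"
proof (rule eq_matI)
  note H = lanczos_H11_carrier[OF T]
  let ?R = "residual_coeffs k \<beta> + lanczos_embedding k * lanczos_H11 T11 T21"
  have R: "?R \<in> carrier_mat (2 * k + 2) (2 * k)"
    using H by (intro carrier_matI) simp_all
  fix i j assume "i < dim_row ?R" "j < dim_col ?R"
  with R have ij: "i < 2 * k + 2" "j < 2 * k" by auto
  have "?R $$ (i, j) = residual_coeffs k \<beta> $$ (i, j)
      + (if i < k then lanczos_H11 T11 T21 $$ (i, j) else if i = k \<or> i = 2 * k + 1 then 0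
         else lanczos_H11 T11 T21 $$ (i - 1, j))"
    using ij H
    by (subst index_add_mat) (auto simp: lanczos_embedding_mult_index[OF H] simp del: index_mult_mat(1))
  also have "\<dots> = lanczos_Ttilde k T11 T21 \<beta> $$ (i, j)"
  proof -
    note defs = lanczos_Ttilde_def append_rows_def append_cols_def mat_conj_def
      lanczos_H11_def residual_coeffs_def mat_of_row_def unit_vec_def
    consider "i < k" | "i = k" | l where "i = k + 1 + l" "l < k" | "i = 2 * k + 1"
    proof -
      have "i = k + 1 + (i - k - 1) \<and> i - k - 1 < k" if "k < i" "i \<noteq> 2 * k + 1"
        using ij that by linarith
      then show ?thesis using that ij by (meson linorder_neqE_nat)
    qed
    then show ?thesis
    proof cases
      case 1
      with ij T k show ?thesis by (cases "j < k"; simp add: defs)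
    next
      case 2
      with ij T k show ?thesis by (cases "j < k"; simp add: defs; arith)
    next
      case 3
      with ij T k show ?thesis by (cases "j < k"; simp add: defs)
    next
      case 4
      with ij T k show ?thesis by (cases "j < k"; simp add: defs; arith)
    qed
  qed
  finally show "lanczos_Ttilde k T11 T21 \<beta> $$ (i, j) = ?R $$ (i, j)" ..
qed (use lanczos_Ttilde_carrier[OF T] lanczos_H11_carrier[OF T]
      lanczos_embedding_carrier[of k] in auto)

text \<open>A change of \<open>S\<close> only moves the coefficients within the range of the embedding, which
  misses the rows on which \<open>residual_coeffs k \<beta>\<close> lives.\<close>

lemma lanczos_residual_factor:
  assumes q: "\<And>i. 1 \<le> i \<Longrightarrow> i \<le> k + 1 \<Longrightarrow> q i \<in> carrier_vec (2 * n)"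
    and T: "T11 \<in> carrier_mat k k" "T21 \<in> carrier_mat k k" and k: "0 < k"
    and S: "S \<in> carrier_mat (2 * k) (2 * k)"
    and decomp: "H * lanczos_basis n q k = lanczos_basis n q (k + 1) * lanczos_Ttilde k T11 T21 \<beta>"
  shows "H * lanczos_basis n q k - lanczos_basis n q k * S =
    lanczos_basis n q (k + 1) *
      (residual_coeffs k \<beta> + lanczos_embedding k * (lanczos_H11 T11 T21 - S))"
proof -
  let ?Q = "lanczos_basis n q (k + 1)" and ?F = "lanczos_embedding k"
    and ?D = "residual_coeffs k \<beta>" and ?H = "lanczos_H11 T11 T21"
  have Q: "?Q \<in> carrier_mat (2 * n) (2 * k + 2)"
    using lanczos_basis_carrier[of n q "k + 1"] by simp
  have F: "?F \<in> carrier_mat (2 * k + 2) (2 * k)" and D: "?D \<in> carrier_mat (2 * k + 2) (2 * k)"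
    by (rule lanczos_embedding_carrier, rule residual_coeffs_carrier)
  have H: "?H \<in> carrier_mat (2 * k) (2 * k)" by (rule lanczos_H11_carrier[OF T])
  have embed: "lanczos_basis n q k = ?Q * ?F"
    by (rule lanczos_basis_eq_mult_embedding) (rule q)
  have "H * lanczos_basis n q k - lanczos_basis n q k * S = ?Q * (?D + ?F * ?H) - ?Q * (?F * S)"
    unfolding decomp lanczos_Ttilde_split[OF T k] unfolding embed assoc_mult_mat[OF Q F S] ..
  also have "\<dots> = ?Q * ((?D + ?F * ?H) - ?F * S)"
    using Q F D H S by (intro mult_minus_distrib_mat[symmetric]) auto
  also have "(?D + ?F * ?H) - ?F * S = ?D + (?F * ?H - ?F * S)"
    using F D H S by (intro eq_matI) (auto)
  also have "?F * ?H - ?F * S = ?F * (?H - S)"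
    using F H S by (intro mult_minus_distrib_mat[symmetric]) auto
  finally show ?thesis .
qed

section \<open>Residual coordinates and their norm\<close>

lemma residual_coeffs_mult_vec:
  assumes "x \<in> carrier_vec (2 * k)" "0 < k"
  shows "residual_coeffs k \<beta> *\<^sub>v x = (\<beta> * x $ (k - 1)) \<cdot>\<^sub>v unit_vec (2 * k + 2) k
    - (x $ (2 * k - 1) * cnj \<beta>) \<cdot>\<^sub>v unit_vec (2 * k + 2) (2 * k + 1)"
proof (rule eq_vecI)
  fix i
  assume "i < dim_vec ((\<beta> * x $ (k - 1)) \<cdot>\<^sub>v unit_vec (2 * k + 2) k
    - (x $ (2 * k - 1) * cnj \<beta>) \<cdot>\<^sub>v unit_vec (2 * k + 2) (2 * k + 1))"
  then have i: "i < 2 * k + 2" by simp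
  have "(residual_coeffs k \<beta> *\<^sub>v x) $ i = (\<Sum>j<2 * k. residual_coeffs k \<beta> $$ (i, j) * x $ j)"
    using i assms residual_coeffs_carrier[of k \<beta>]
    by (auto simp: scalar_prod_def atLeast0LessThan)
  also have "\<dots> = (\<Sum>j<2 * k. (if j = k - 1 then (if i = k then \<beta> * x $ j else 0) else 0)
      + (if j = 2 * k - 1 then (if i = 2 * k + 1 then - cnj \<beta> * x $ j else 0) else 0))"
    using i assms by (intro sum.cong) (auto simp: residual_coeffs_def)
  also have "\<dots> = (if i = k then \<beta> * x $ (k - 1) else 0)
      + (if i = 2 * k + 1 then - cnj \<beta> * x $ (2 * k - 1) else 0)"
    using assms less_imp_diff_less[of k "2 * k" 1] by (simp add: sum.distrib)
  finally show "(residual_coeffs k \<beta> *\<^sub>v x) $ i = ((\<beta> * x $ (k - 1)) \<cdot>\<^sub>v unit_vec (2 * k + 2) k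
    - (x $ (2 * k - 1) * cnj \<beta>) \<cdot>\<^sub>v unit_vec (2 * k + 2) (2 * k + 1)) $ i"
    using i assms by (auto simp: unit_vec_def)
qed (use residual_coeffs_carrier[of k \<beta>] in auto)

text \<open>Padding with zero rows does not change norms, and the only nonzero coordinates of the image
  of \<open>v\<close> are \<open>\<beta> * v $ (k - 1)\<close> and \<open>- cnj \<beta> * v $ (2 * k - 1)\<close>. They involve different
  coordinates of \<open>v\<close>, so their joint norm is at most \<open>|\<beta>|\<close> times that of \<open>v\<close>.\<close>

lemma spectral_norm_residual_coeffs_le:
  assumes k: "0 < k" and r: "2 * k + 2 \<le> r"
  shows "spectral_norm (selection_mat r (2 * k + 2) (\<lambda>j. j) * residual_coeffs k \<beta>) \<le> cmod \<beta>"
proof (rule spectral_norm_le)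
  let ?A = "selection_mat r (2 * k + 2) (\<lambda>j. j) * residual_coeffs k \<beta>"
  have A: "?A \<in> carrier_mat r (2 * k)"
    using selection_mat_carrier residual_coeffs_carrier by (rule mult_carrier_mat)
  fix v assume "v \<in> carrier_vec (dim_col ?A)" and v1: "vec_norm2 v \<le> 1"
  with A have v: "v \<in> carrier_vec (2 * k)" by auto
  let ?y = "residual_coeffs k \<beta> *\<^sub>v v"
  let ?a = "\<lambda>i. if i < 2 * k + 2 then ?y $ i else 0"
  have entry: "(?A *\<^sub>v v) $ i = ?a i" if i: "i < r" for i
  proof -
    have "(?A *\<^sub>v v) $ i = (\<Sum>j<2 * k. ?A $$ (i, j) * v $ j)"
      using i v by (simp add: scalar_prod_def atLeast0LessThan)
    also have "\<dots> = (\<Sum>j<2 * k. (if i < 2 * k + 2 then residual_coeffs k \<beta> $$ (i, j) else 0) * v $ j)"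
      by (intro sum.cong refl)
        (simp only: selection_mat_id_mult_index[OF residual_coeffs_carrier r i] lessThan_iff)
    also have "\<dots> = ?a i"
      using i v residual_coeffs_carrier[of k \<beta>]
      by (auto simp: scalar_prod_def atLeast0LessThan)
    finally show ?thesis .
  qed
  have y: "?a i = (if i = k then \<beta> * v $ (k - 1) else if i = 2 * k + 1
      then - (v $ (2 * k - 1) * cnj \<beta>) else 0)" for i
    by (auto simp: residual_coeffs_mult_vec[OF v k] unit_vec_def)
  have "(vec_norm2 (?A *\<^sub>v v))\<^sup>2 = (\<Sum>i<r. (cmod (?a i))\<^sup>2)"
    using A entry by (auto simp: vec_norm2_def L2_set_def sum_nonneg intro!: sum.cong)
  also have "\<dots> = (\<Sum>i\<in>{k, 2 * k + 1}. (cmod (?a i))\<^sup>2)"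
    unfolding y using r by (intro sum.mono_neutral_right) auto
  also have "\<dots> = (cmod \<beta>)\<^sup>2 * (\<Sum>i\<in>{k - 1, 2 * k - 1}. (cmod (v $ i))\<^sup>2)"
    unfolding y using k by (simp add: norm_mult power_mult_distrib algebra_simps)
  also have "\<dots> \<le> (cmod \<beta>)\<^sup>2 * (\<Sum>i<2 * k. (cmod (v $ i))\<^sup>2)"
    using k by (intro mult_left_mono sum_mono2) auto
  also have "(\<Sum>i<2 * k. (cmod (v $ i))\<^sup>2) = (vec_norm2 v)\<^sup>2"
    using v by (auto simp: vec_norm2_def L2_set_def sum_nonneg)
  also have "(cmod \<beta>)\<^sup>2 * (vec_norm2 v)\<^sup>2 \<le> (cmod \<beta>)\<^sup>2 * 1"
    using v1 by (intro mult_left_mono power_le_one) (auto simp: vec_norm2_def)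
  finally show "vec_norm2 (?A *\<^sub>v v) \<le> cmod \<beta>"
    by (simp add: power2_le_iff_abs_le)
qed

text \<open>Row \<open>k\<close> of \<open>F Y\<close> is zero, so the entry \<open>\<beta>\<close> of \<open>D\<close> in that row survives for every
  \<open>Y\<close>.\<close>

lemma spectral_norm_residual_ge:
  assumes k: "0 < k" and r: "2 * k + 2 \<le> r" and Y: "Y \<in> carrier_mat (2 * k) (2 * k)"
  shows "cmod \<beta> \<le> spectral_norm
    (selection_mat r (2 * k + 2) (\<lambda>j. j) * (residual_coeffs k \<beta> + lanczos_embedding k * Y))"
proof -
  let ?X = "residual_coeffs k \<beta> + lanczos_embedding k * Y"
  let ?A = "selection_mat r (2 * k + 2) (\<lambda>j. j) * ?X"
  have FY: "lanczos_embedding k * Y \<in> carrier_mat (2 * k + 2) (2 * k)"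
    using lanczos_embedding_carrier Y by (rule mult_carrier_mat)
  then have X: "?X \<in> carrier_mat (2 * k + 2) (2 * k)" by (rule add_carrier_mat)
  then have A: "?A \<in> carrier_mat r (2 * k)"
    using selection_mat_carrier by (intro mult_carrier_mat)
  have "?A $$ (k, k - 1) = ?X $$ (k, k - 1)"
    using k r by (subst selection_mat_id_mult_index[OF X]) auto
  also have "\<dots> = \<beta>"
    using k FY lanczos_embedding_mult_index[OF Y, of k "k - 1"]
    by (subst index_add_mat) (auto simp: residual_coeffs_def)
  finally show ?thesis
    using cmod_index_le_spectral_norm[of k ?A "k - 1"] k r Y by simp
qed

section \<open>The completed basis\<close>

text \<open>Invertibility only provides an inverse matrix of unspecified shape. Its shape is read off
  the two identities that it satisfies; this puts \<open>A\<close> among the units of the matrix ring, where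
  Gauss-Jordan elimination cannot fail.\<close>

lemma mult_mat_inverse_left:
  fixes A :: "'a :: field mat"
  assumes A: "A \<in> carrier_mat n n" and inv: "invertible_mat A"
  shows "the (mat_inverse A) \<in> carrier_mat n n" "the (mat_inverse A) * A = 1\<^sub>m n"
proof -
  from inv A obtain B where AB: "A * B = 1\<^sub>m n" and BA: "B * A = 1\<^sub>m (dim_row B)"
    by (auto simp: invertible_mat_def inverts_mat_def)
  have "dim_col B = n" using arg_cong[OF AB, of dim_col] by simp
  moreover have "dim_row B = n" using arg_cong[OF BA, of dim_col] A by simp
  ultimately have "B \<in> carrier_mat n n" by auto
  then have "A \<in> Units (ring_mat TYPE('a) n ())"
    using A AB BA by (auto simp: Units_def ring_mat_simps)
  then obtain C where "mat_inverse A = Some C"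
    using mat_inverse(1)[OF A, of "()"] by (cases "mat_inverse A") auto
  with mat_inverse(2)[OF A this]
  show "the (mat_inverse A) \<in> carrier_mat n n" "the (mat_inverse A) * A = 1\<^sub>m n" by auto
qed

text \<open>\<open>X\<close> arises from \<open>[X Y]\<close> by selecting the first columns, and selecting columns commutes
  with multiplication by \<open>P\<close> from the left.\<close>

lemma left_inverse_append_cols:
  assumes X: "X \<in> carrier_mat m r" and Y: "Y \<in> carrier_mat m s"
    and P: "P \<in> carrier_mat m m" and inv: "P * (X @\<^sub>c Y) = 1\<^sub>m m" and m: "m = r + s"
  shows "P * X = selection_mat m r (\<lambda>j. j)"
proof -
  let ?I = "selection_mat m r (\<lambda>j. j)"
  have XY: "X @\<^sub>c Y \<in> carrier_mat m m"
    using X Y m by (auto simp: append_cols_def)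
  have "X = (X @\<^sub>c Y) * ?I"
  proof (rule eq_matI)
    fix i j assume "i < dim_row ((X @\<^sub>c Y) * ?I)" "j < dim_col ((X @\<^sub>c Y) * ?I)"
    then have ij: "i < m" "j < r" using XY selection_mat_carrier[of m r "\<lambda>j. j"] by auto
    then have "((X @\<^sub>c Y) * ?I) $$ (i, j) = (X @\<^sub>c Y) $$ (i, j)"
      using m by (subst mult_selection_mat_index[OF XY]) auto
    also have "\<dots> = X $$ (i, j)"
      using ij X Y by (auto simp: append_cols_def)
    finally show "X $$ (i, j) = ((X @\<^sub>c Y) * ?I) $$ (i, j)" ..
  qed (use X XY selection_mat_carrier[of m r "\<lambda>j. j"] in auto)
  then have "P * X = P * ((X @\<^sub>c Y) * ?I)" by simp
  also have "\<dots> = (P * (X @\<^sub>c Y)) * ?I"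
    using P XY by (intro assoc_mult_mat[symmetric]) auto
  also have "\<dots> = ?I"
    by (simp add: inv left_mult_one_mat[OF selection_mat_carrier])
  finally show ?thesis .
qed

theorem theorem4p8:
  fixes n k :: nat
    and A B T11 T21 \<Gamma> Q\<^sub>u Q Q2k H H11 :: "complex mat"
    and q :: "nat \<Rightarrow> complex vec"
    and x :: "complex vec"
    and \<beta> \<nu> :: complex
  assumes "A \<in> carrier_mat n n" and "B \<in> carrier_mat n n"
    and "mat_adjoint A = A" and "transpose_mat B = B"
    and "gamma_lanczos_decomp n k A B q \<Gamma> T11 T21 \<beta>"
    and "lanczos_completion n k q \<Gamma> Q\<^sub>u"
    and H: "H = ham_mat A B"
    and Q2k: "Q2k = lanczos_basis n q k"
    and Q: "Q = lanczos_basis n q (k + 1) @\<^sub>c Q\<^sub>u"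
    and H11: "H11 = lanczos_H11 T11 T21"
    and "x \<in> carrier_vec (2 * k)" and "x \<noteq> 0\<^sub>v (2 * k)"
    and "H11 *\<^sub>v x = \<nu> \<cdot>\<^sub>v x"
  shows "(spectral_norm (the (mat_inverse Q) * (H * Q2k - Q2k * H11)) = cmod \<beta> \<and>
          is_minimum (cmod \<beta>)
            {spectral_norm (the (mat_inverse Q) * (H * Q2k - Q2k * S)) | S.
               S \<in> carrier_mat (2 * k) (2 * k)}) \<and>
         H *\<^sub>v (Q2k *\<^sub>v x) - \<nu> \<cdot>\<^sub>v (Q2k *\<^sub>v x) =
         (\<beta> * x $ (k - 1)) \<cdot>\<^sub>v q (k + 1)
           - (x $ (2 * k - 1) * cnj \<beta>) \<cdot>\<^sub>v (Pi_mat n *\<^sub>v conjugate (q (k + 1)))"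
proof -
  let ?L = "lanczos_basis n q (k + 1)" and ?D = "residual_coeffs k \<beta>"
    and ?F = "lanczos_embedding k" and ?P = "the (mat_inverse Q)"
    and ?I = "selection_mat (2 * n) (2 * k + 2) (\<lambda>j. j)"
  from assms(5) have k: "0 < k" "k < n"
    and q: "\<And>i. 1 \<le> i \<Longrightarrow> i \<le> k + 1 \<Longrightarrow> q i \<in> carrier_vec (2 * n)"
    and T: "T11 \<in> carrier_mat k k" "T21 \<in> carrier_mat k k"
    and decomp: "H * Q2k = ?L * lanczos_Ttilde k T11 T21 \<beta>"
    unfolding gamma_lanczos_decomp_def H Q2k by auto
  have H11c: "H11 \<in> carrier_mat (2 * k) (2 * k)"
    unfolding H11 by (rule lanczos_H11_carrier[OF T])
  have Hc: "H \<in> carrier_mat (2 * n) (2 * n)"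
    unfolding H ham_mat_def mat_conj_def using assms(1,2) by auto
  have Q2kc: "Q2k \<in> carrier_mat (2 * n) (2 * k)"
    unfolding Q2k by (rule lanczos_basis_carrier)
  have L: "?L \<in> carrier_mat (2 * n) (2 * k + 2)"
    using lanczos_basis_carrier[of n q "k + 1"] by simp
  have Qu: "Q\<^sub>u \<in> carrier_mat (2 * n) (2 * n - (2 * k + 2))"
    using assms(6) k by (auto simp: lanczos_completion_def mat_conj_def)
  have Qc: "Q \<in> carrier_mat (2 * n) (2 * n)"
    unfolding Q append_cols_def using L Qu k by auto
  have "invertible_mat Q"
    using assms(6) unfolding lanczos_completion_def Q by (simp add: Let_def)
  note P = mult_mat_inverse_left[OF Qc this]
  have PL: "?P * ?L = ?I"
    using left_inverse_append_cols[OF L Qu P(1)] P(2) k unfolding Q by auto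
  have factor: "H * Q2k - Q2k * S = ?L * (?D + ?F * (H11 - S))"
    if "S \<in> carrier_mat (2 * k) (2 * k)" for S
    using lanczos_residual_factor[of k q n T11 T21 S H \<beta>] q T k that decomp
    unfolding Q2k H11 by blast
  have coords: "?P * (H * Q2k - Q2k * S) = ?I * (?D + ?F * (H11 - S))"
    if S: "S \<in> carrier_mat (2 * k) (2 * k)" for S
  proof -
    have "?F * (H11 - S) \<in> carrier_mat (2 * k + 2) (2 * k)"
      using lanczos_embedding_carrier minus_carrier_mat[OF S] by (rule mult_carrier_mat)
    then have "?D + ?F * (H11 - S) \<in> carrier_mat (2 * k + 2) (2 * k)"
      by (rule add_carrier_mat)
    then show ?thesis
      unfolding factor[OF S] PL[symmetric]
      by (rule assoc_mult_mat[OF P(1) L, symmetric])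
  qed
  have zero: "?D + ?F * (H11 - H11) = ?D"
    by (simp only: minus_r_inv_mat[OF H11c] right_mult_zero_mat[OF lanczos_embedding_carrier]
        right_add_zero_mat[OF residual_coeffs_carrier])
  have ge: "cmod \<beta> \<le> spectral_norm (?P * (H * Q2k - Q2k * S))"
    if S: "S \<in> carrier_mat (2 * k) (2 * k)" for S
    unfolding coords[OF S] using k S by (intro spectral_norm_residual_ge) auto
  have "spectral_norm (?P * (H * Q2k - Q2k * H11)) \<le> cmod \<beta>"
    unfolding coords[OF H11c] zero using k by (intro spectral_norm_residual_coeffs_le) auto
  with ge[OF H11c] have norm: "spectral_norm (?P * (H * Q2k - Q2k * H11)) = cmod \<beta>"
    by (rule order_antisym[rotated])
  have min: "is_minimum (cmod \<beta>)
      {spectral_norm (?P * (H * Q2k - Q2k * S)) | S. S \<in> carrier_mat (2 * k) (2 * k)}"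
    unfolding is_minimum_def using norm[symmetric] H11c ge by blast
  note x = assms(11)
  have "H *\<^sub>v (Q2k *\<^sub>v x) - \<nu> \<cdot>\<^sub>v (Q2k *\<^sub>v x) = H *\<^sub>v (Q2k *\<^sub>v x) - Q2k *\<^sub>v (H11 *\<^sub>v x)"
    using mult_mat_vec[OF Q2kc x] assms(13) by simp
  also have "\<dots> = (H * Q2k) *\<^sub>v x - (Q2k * H11) *\<^sub>v x"
    using assoc_mult_mat_vec[OF Hc Q2kc x] assoc_mult_mat_vec[OF Q2kc H11c x] by simp
  also have "\<dots> = (H * Q2k - Q2k * H11) *\<^sub>v x"
    using Hc Q2kc H11c x by (intro minus_mult_distrib_mat_vec[symmetric]) auto
  also have "\<dots> = ?L *\<^sub>v (?D *\<^sub>v x)"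
    unfolding factor[OF H11c] zero by (rule assoc_mult_mat_vec[OF L residual_coeffs_carrier x])
  also have "\<dots> = (\<beta> * x $ (k - 1)) \<cdot>\<^sub>v (?L *\<^sub>v unit_vec (2 * k + 2) k)
      - (x $ (2 * k - 1) * cnj \<beta>) \<cdot>\<^sub>v (?L *\<^sub>v unit_vec (2 * k + 2) (2 * k + 1))"
    unfolding residual_coeffs_mult_vec[OF x k(1)]
    by (simp only: mult_minus_distrib_mat_vec[OF L] mult_mat_vec[OF L] smult_carrier_vec
        unit_vec_carrier)
  also have "?L *\<^sub>v unit_vec (2 * k + 2) k = q (k + 1)"
    using lanczos_basis_col[of k "k + 1" q n] q mult_mat_vec_unit_vec[OF L, of k] by simp
  also have "?L *\<^sub>v unit_vec (2 * k + 2) (2 * k + 1) = Pi_mat n *\<^sub>v conjugate (q (k + 1))"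
    using lanczos_basis_col[of "2 * k + 1" "k + 1" q n] q mult_mat_vec_unit_vec[OF L, of "2 * k + 1"]
    by simp
  finally show ?thesis using norm min by blast
qed

end
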